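(* Let $Q\subseteq\mathbb{R}^n$ be a nonempty polytope, $p\in\mathbb{R}^n$, $\psi(x)=p\cdot x$, $\varepsilon\ge0$, and let $\mathcal B$ be the set of edges of $Q$. Then $$\mathbb{P}(\mathrm{ER}(\varepsilon)^c)\ \le\ \varepsilon\,\frac{e}{\sqrt{2\pi}}\sum_{f\in\mathcal B}\gamma_{\mathrm{rel}}(N(f))\,|s_f\cdot p|\,\exp\big(\varepsilon\sqrt{n-1}\,\|p\|\big).$$
   Context: An edge of $Q$ is a $1$-dimensional face. $N(x)=\{v\in\mathbb{R}^n\mid v\cdot(y-x)\le0\ \text{for all }y\in Q\}$ is the normal cone to $Q$ at $x\in Q$; for an edge $f$, $N(f)$ denotes the normal cone at any point of the relative interior of $f$ (it does not depend on the point). $s_f$ is a unit vector in $\mathrm{span}(f-f)$, i.e. parallel to the edge $f$ (either of the two choices). For a cone $K\subseteq\mathbb{R}^n$, $\gamma_{\mathrm{rel}}(K)=\mathbb{P}(\mathrm{proj}_{\mathrm{span}(K)}\,g\in K)$ with $g\sim\mathcal N(0,I_n)$. Let $g\sim\mathcal N(0,I_n)$. (LP): minimize $-g\cdot x$ over $x\in Q$. $(P_\varepsilon)$: minimize $-g\cdot x+\varepsilon\psi(x)$ over $x\in Q$. With probability 1, (LP) has a unique solution $z^\star$, a vertex of $Q$. $\mathrm{ER}(\varepsilon)$ is the event that $z^\star$ is also a solution of $(P_\varepsilon)$, and $\mathrm{ER}(\varepsilon)^c$ is its complement. *)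

theory Defs
  imports "HOL-Probability.Probability"
begin

text \<open>The density of \<open>N(0, I\<^sub>n)\<close>: independent standard normal coordinates.\<close>

definition std_gaussian_density :: "real ^ 'n \<Rightarrow> real" where
  "std_gaussian_density x = (\<Prod>i\<in>UNIV. std_normal_density (x $ i))"

definition std_gaussian :: "(real ^ 'n) measure" where
  "std_gaussian = density lborel (\<lambda>x. ennreal (std_gaussian_density x))"

definition normal_cone :: "(real ^ 'n) set \<Rightarrow> real ^ 'n \<Rightarrow> (real ^ 'n) set" where
  "normal_cone Q x = {v. \<forall>y\<in>Q. v \<bullet> (y - x) \<le> 0}"

text \<open>Independence of the chosen point is \<open>face_normal_cone_eq\<close> below.\<close>

definition face_normal_cone :: "(real ^ 'n) set \<Rightarrow> (real ^ 'n) set \<Rightarrow> (real ^ 'n) set" where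
  "face_normal_cone Q f = normal_cone Q (SOME x. x \<in> rel_interior f)"

text \<open>\<open>closest_point (span K)\<close> is the orthogonal projection onto \<open>span K\<close>.\<close>

definition gamma_rel :: "(real ^ 'n) set \<Rightarrow> real" where
  "gamma_rel K = measure std_gaussian {g. closest_point (span K) g \<in> K}"

definition lp_solution :: "(real ^ 'n) set \<Rightarrow> real ^ 'n \<Rightarrow> real ^ 'n \<Rightarrow> bool" where
  "lp_solution Q g = is_arg_min (\<lambda>x. - (g \<bullet> x)) (\<lambda>x. x \<in> Q)"

definition perturbed_solution ::
  "(real ^ 'n) set \<Rightarrow> (real ^ 'n \<Rightarrow> real) \<Rightarrow> real \<Rightarrow> real ^ 'n \<Rightarrow> real ^ 'n \<Rightarrow> bool" where
  "perturbed_solution Q \<psi> \<epsilon> g = is_arg_min (\<lambda>x. - (g \<bullet> x) + \<epsilon> * \<psi> x) (\<lambda>x. x \<in> Q)"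

text \<open>
  The null set of those \<open>g\<close> for which the linear program has no unique solution is counted as part
  of the complement of the event; this also makes the event measurable
  (\<open>exact_regularization_measurable\<close> below).
\<close>

definition exact_regularization ::
  "(real ^ 'n) set \<Rightarrow> (real ^ 'n \<Rightarrow> real) \<Rightarrow> real \<Rightarrow> real ^ 'n \<Rightarrow> bool" where
  "exact_regularization Q \<psi> \<epsilon> g \<longleftrightarrow>
     (\<exists>!z. lp_solution Q g z) \<and> perturbed_solution Q \<psi> \<epsilon> g (THE z. lp_solution Q g z)"


lemma normal_cone_rel_interior_subset:
  assumes "convex f" "f \<subseteq> Q" "x \<in> rel_interior f" "y \<in> rel_interior f"
  shows "normal_cone Q x \<subseteq> normal_cone Q y"
proof
  fix v assume v: "v \<in> normal_cone Q x"
  have "y \<in> affine hull f"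
    using assms(4) rel_interior_subset[of f] by (auto intro: hull_inc)
  then obtain e where e: "e > 1" "(1 - e) *\<^sub>R y + e *\<^sub>R x \<in> f"
    using bspec[OF convex_rel_interior_if2[OF assms(1,3)]] by auto
  have "(1 - e) *\<^sub>R y + e *\<^sub>R x - x = (e - 1) *\<^sub>R (x - y)"
    by (simp add: algebra_simps)
  moreover have "v \<bullet> ((1 - e) *\<^sub>R y + e *\<^sub>R x - x) \<le> 0"
    using v e(2) assms(2) by (auto simp: normal_cone_def)
  ultimately have "(e - 1) * (v \<bullet> (x - y)) \<le> 0"
    by (metis inner_scaleR_right)
  with e(1) have xy: "v \<bullet> (x - y) \<le> 0"
    by (simp add: mult_le_0_iff)
  have "v \<bullet> (z - y) \<le> 0" if "z \<in> Q" for z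
  proof -
    have "v \<bullet> (z - x) \<le> 0"
      using v that by (auto simp: normal_cone_def)
    with xy show ?thesis
      by (simp add: inner_diff_right)
  qed
  then show "v \<in> normal_cone Q y"
    by (simp add: normal_cone_def)
qed

lemma face_normal_cone_eq:
  assumes "convex Q" "f face_of Q" "x \<in> rel_interior f"
  shows "face_normal_cone Q f = normal_cone Q x"
proof -
  have "convex f" "f \<subseteq> Q"
    using assms(1,2) by (auto simp: face_of_imp_convex face_of_imp_subset)
  moreover have "(SOME x. x \<in> rel_interior f) \<in> rel_interior f"
    using assms(3) by (rule someI)
  ultimately show ?thesis
    unfolding face_normal_cone_def
    using normal_cone_rel_interior_subset assms(3) by (metis subset_antisym)
qed

lemma closed_normal_cone: "closed (normal_cone Q x)"
proof -
  have eq: "normal_cone Q x = (\<Inter>y\<in>Q. {v. v \<bullet> (y - x) \<le> 0})"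
    by (auto simp: normal_cone_def)
  show ?thesis
    unfolding eq by (intro closed_INT ballI closed_Collect_le continuous_intros)
qed

lemma gamma_rel_set_closed:
  fixes K :: "(real ^ 'n) set"
  assumes "closed K"
  shows "closed {g. closest_point (span K) g \<in> K}"
proof -
  have "continuous_on UNIV (closest_point (span K))"
    using span_0[of K]
    by (intro continuous_on_closest_point subspace_imp_convex closed_subspace subspace_span) auto
  then have "closed (closest_point (span K) -` K)"
    using assms continuous_on_closed_vimage[of UNIV "closest_point (span K)"] by auto
  then show ?thesis
    by (simp add: vimage_def)
qed

lemma unique_lp_solution_convex_hull:
  fixes V :: "(real ^ 'n) set"
  assumes "finite V"
  shows "(lp_solution (convex hull V) g z \<and> (\<exists>!z. lp_solution (convex hull V) g z))
    \<longleftrightarrow> z \<in> V \<and> (\<forall>v\<in>V - {z}. g \<bullet> v < g \<bullet> z)"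
proof
  assume L: "lp_solution (convex hull V) g z \<and> (\<exists>!z. lp_solution (convex hull V) g z)"
  then have "z \<in> convex hull V"
    by (simp add: lp_solution_def is_arg_min_def)
  then have ne: "V \<noteq> {}"
    by auto
  have sol: "lp_solution (convex hull V) g w" if "w \<in> V" "\<forall>v\<in>V. g \<bullet> v \<le> g \<bullet> w" for w
  proof -
    have "convex hull V \<subseteq> {x. g \<bullet> x \<le> g \<bullet> w}"
      using that(2) by (intro hull_minimal convex_halfspace_le) auto
    then show ?thesis
      using that(1) hull_inc[of w V convex]
      by (auto simp: lp_solution_def is_arg_min_linorder)
  qed
  have "Max ((\<lambda>v. g \<bullet> v) ` V) \<in> (\<lambda>v. g \<bullet> v) ` V"
    using assms ne by (intro Max_in) auto
  then obtain w where wV: "w \<in> V" and wmax: "g \<bullet> w = Max ((\<lambda>v. g \<bullet> v) ` V)"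
    by auto
  have w: "w \<in> V" "\<forall>v\<in>V. g \<bullet> v \<le> g \<bullet> w"
    using assms wV unfolding wmax by auto
  with L sol have wz: "w = z"
    by blast
  have "g \<bullet> v < g \<bullet> z" if "v \<in> V - {z}" for v
  proof (rule ccontr)
    assume "\<not> g \<bullet> v < g \<bullet> z"
    then have "lp_solution (convex hull V) g v"
      using that w wz by (intro sol) (auto intro: order_trans)
    with L that show False
      by blast
  qed
  with w wz show "z \<in> V \<and> (\<forall>v\<in>V - {z}. g \<bullet> v < g \<bullet> z)"
    by blast
next
  assume A: "z \<in> V \<and> (\<forall>v\<in>V - {z}. g \<bullet> v < g \<bullet> z)"
  let ?S = "insert z {x. g \<bullet> x < g \<bullet> z}"
  have "convex ?S"
    unfolding convex_alt
  proof (intro ballI allI impI)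
    fix x y and u :: real
    assume x: "x \<in> ?S" and y: "y \<in> ?S" and u: "0 \<le> u \<and> u \<le> 1"
    have le: "g \<bullet> x \<le> g \<bullet> z" "g \<bullet> y \<le> g \<bullet> z"
      using x y by auto
    show "(1 - u) *\<^sub>R x + u *\<^sub>R y \<in> ?S"
    proof (cases "u = 0 \<or> u = 1 \<or> (x = z \<and> y = z)")
      case True
      then show ?thesis
        using x y by (auto simp: algebra_simps)
    next
      case False
      then have u': "0 < u" "0 < 1 - u"
        using u by auto
      from False x y have "g \<bullet> x < g \<bullet> z \<or> g \<bullet> y < g \<bullet> z"
        by auto
      then have "(1 - u) * (g \<bullet> x) + u * (g \<bullet> y) < (1 - u) * (g \<bullet> z) + u * (g \<bullet> z)"
      proof
        assume "g \<bullet> x < g \<bullet> z"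
        then show ?thesis
          using u' le by (intro add_less_le_mono mult_strict_left_mono mult_left_mono) auto
      next
        assume "g \<bullet> y < g \<bullet> z"
        then show ?thesis
          using u' le by (intro add_le_less_mono mult_strict_left_mono mult_left_mono) auto
      qed
      then show ?thesis
        by (simp add: algebra_simps)
    qed
  qed
  then have "convex hull V \<subseteq> ?S"
    using A by (intro hull_minimal) auto
  moreover have "z \<in> convex hull V"
    using A by (simp add: hull_inc)
  ultimately have "lp_solution (convex hull V) g x \<longleftrightarrow> x = z" for x
    by (fastforce simp: lp_solution_def is_arg_min_linorder)
  then show "lp_solution (convex hull V) g z \<and> (\<exists>!z. lp_solution (convex hull V) g z)"
    by auto
qed

lemma exact_regularization_measurable:
  fixes Q :: "(real ^ 'n) set"
  assumes "polytope Q"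
  shows "{g. exact_regularization Q \<psi> \<epsilon> g} \<in> sets borel"
proof -
  obtain V where V: "finite V" "Q = convex hull V"
    using assms by (auto simp: polytope_def)
  define U where "U z = (\<Inter>v\<in>V - {z}. {g. g \<bullet> v < g \<bullet> z})" for z
  define C where "C z = (\<Inter>y\<in>Q. {g. - (g \<bullet> z) + \<epsilon> * \<psi> z \<le> - (g \<bullet> y) + \<epsilon> * \<psi> y})" for z
  have ER: "exact_regularization Q \<psi> \<epsilon> g \<longleftrightarrow>
      (\<exists>z. (lp_solution Q g z \<and> (\<exists>!z. lp_solution Q g z)) \<and> perturbed_solution Q \<psi> \<epsilon> g z)" for g
    unfolding exact_regularization_def by (metis the1_equality theI')
  have P: "perturbed_solution Q \<psi> \<epsilon> g z \<longleftrightarrow> z \<in> Q \<and> g \<in> C z" for g z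
    by (auto simp: perturbed_solution_def is_arg_min_linorder C_def)
  have L: "(lp_solution Q g z \<and> (\<exists>!z. lp_solution Q g z)) \<longleftrightarrow> z \<in> V \<and> g \<in> U z" for g z
    unfolding V(2) unique_lp_solution_convex_hull[OF V(1)] by (simp add: U_def)
  have "V \<subseteq> Q"
    unfolding V(2) by (rule hull_subset)
  then have "{g. exact_regularization Q \<psi> \<epsilon> g} = (\<Union>z\<in>V. U z \<inter> C z)"
    unfolding ER P L by blast
  moreover have "open (U z)" for z
    unfolding U_def using V(1)
    by (intro open_INT finite_Diff ballI open_Collect_less continuous_intros)
  moreover have "closed (C z)" for z
    unfolding C_def by (intro closed_INT ballI closed_Collect_le continuous_intros)
  ultimately show ?thesis
    using V(1) by auto
qed

end

theory Submission
  imports Defs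
begin

text \<open>
  If exact regularization fails for \<open>g\<close>, then somewhere on the segment from \<open>g\<close> to \<open>g - \<epsilon> p\<close> the
  maximizer over \<open>Q\<close> is not unique, hence \<open>g - t p \<in> N(f)\<close> for some edge \<open>f\<close> and
  \<open>t \<in> [0, \<epsilon>]\<close>. Since \<open>N(f)\<close> lies in the hyperplane \<open>s\<^sub>f\<^sup>\<bottom>\<close>, the coordinate of \<open>g\<close> along
  \<open>s\<^sub>f\<close> determines \<open>t\<close> and ranges over an interval of length \<open>\<epsilon> \<bar>s\<^sub>f \<bullet> p\<bar>\<close>, on which
  its density is at most \<open>1 / sqrt (2 * pi)\<close>. For fixed \<open>t\<close>, the orthogonal part of \<open>g\<close> lies in a
  translate by \<open>b\<close> of the cone \<open>N(f)\<close>. Substituting \<open>x = sqrt (1 + u) y\<close> in the Gaussian integral and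
  estimating the cross term by AM-GM shows that a translation raises the measure of a cone in
  dimension \<open>d = n - 1\<close> by a factor of at most \<open>(1 + u) powr (d / 2) * exp (\<bar>b\<bar>\<^sup>2 / (2 u))\<close>, and
  \<open>u = \<bar>b\<bar> / sqrt d\<close> makes this at most \<open>exp (\<bar>b\<bar> * sqrt d)\<close>.
\<close>

section \<open>Decomposition along a unit vector\<close>

text \<open>For a unit vector \<open>s\<close> this is the orthogonal projection onto the hyperplane
  of vectors orthogonal to \<open>s\<close>. Keeping it as a map into the full space avoids
  coordinates on the hyperplane.\<close>

definition orth_part :: "'a::euclidean_space \<Rightarrow> 'a \<Rightarrow> 'a" where
  "orth_part s x = x - (s \<bullet> x) *\<^sub>R s"

lemma borel_measurable_orth_part [measurable]: "orth_part s \<in> borel_measurable borel"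
  unfolding orth_part_def by (intro borel_measurable_continuous_onI continuous_intros)

lemma orth_part_add: "orth_part s (x + y) = orth_part s x + orth_part s y"
  by (simp add: orth_part_def algebra_simps)

lemma orth_part_scaleR: "orth_part s (c *\<^sub>R x) = c *\<^sub>R orth_part s x"
  by (simp add: orth_part_def algebra_simps)

lemma orth_part_self: "norm s = 1 \<Longrightarrow> orth_part s s = 0"
  using norm_eq_1[of s] by (simp add: orth_part_def)

lemma orth_part_eq: "s \<bullet> x = 0 \<Longrightarrow> orth_part s x = x"
  by (simp add: orth_part_def)

lemma inner_orth_part: "norm s = 1 \<Longrightarrow> s \<bullet> orth_part s x = 0"
  using norm_eq_1[of s] by (simp add: orth_part_def inner_diff_right)

lemma norm_orth_part: "norm s = 1 \<Longrightarrow> (norm x)\<^sup>2 = (s \<bullet> x)\<^sup>2 + (norm (orth_part s x))\<^sup>2"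
  using norm_eq_1[of s] unfolding power2_norm_eq_inner orth_part_def
  by (simp add: inner_diff_left inner_diff_right inner_commute power2_eq_square)

lemma norm_orth_part_le:
  assumes "norm s = 1"
  shows "norm (orth_part s x) \<le> norm x"
proof (rule power2_le_imp_le)
  show "(norm (orth_part s x))\<^sup>2 \<le> (norm x)\<^sup>2"
    unfolding norm_orth_part[OF assms, of x] by simp
qed simp

section \<open>Changes of variables in Lebesgue integrals\<close>

lemma ennreal_mult3:
  assumes "0 \<le> a" "0 \<le> b" "0 \<le> c"
  shows "ennreal a * (ennreal b * (ennreal c * x)) = ennreal (a * b * c) * x"
  using assms by (simp add: ennreal_mult mult.assoc)

lemma nn_integral_lborel_affine:
  fixes f :: "'a::euclidean_space \<Rightarrow> ennreal"
  assumes [measurable]: "f \<in> borel_measurable borel" and c: "c \<noteq> 0"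
  shows "(\<integral>\<^sup>+x. f x \<partial>lborel) = ennreal (\<bar>c\<bar> ^ DIM('a)) * (\<integral>\<^sup>+x. f (t + c *\<^sub>R x) \<partial>lborel)"
  by (subst lborel_affine[OF c, of t])
     (simp add: nn_integral_density nn_integral_distr nn_integral_cmult)

lemma nn_integral_lborel_shift:
  fixes f :: "'a::euclidean_space \<Rightarrow> ennreal"
  assumes "f \<in> borel_measurable borel"
  shows "(\<integral>\<^sup>+x. f (t + x) \<partial>lborel) = (\<integral>\<^sup>+x. f x \<partial>lborel)"
  using nn_integral_lborel_affine[OF assms, of 1 t] by simp

lemma nn_integral_normal_density:
  "\<sigma> > 0 \<Longrightarrow> (\<integral>\<^sup>+x. ennreal (normal_density \<mu> \<sigma> x) \<partial>lborel) = 1"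
  using prob_space.emeasure_space_1[OF prob_space_normal_density, of \<sigma> \<mu>]
  by (simp add: emeasure_density)

text \<open>Insert the factor \<open>\<integral> \<phi>(c - r) dr = 1\<close>, exchange the integrals, translate by \<open>r s\<close>, and
  exchange back: this separates the coordinate along \<open>s\<close> without choosing an orthonormal basis.\<close>

lemma nn_integral_split_direction:
  fixes s :: "'a::euclidean_space" and H :: "real \<Rightarrow> 'a \<Rightarrow> ennreal"
  assumes s: "norm s = 1"
    and H [measurable]: "case_prod H \<in> borel_measurable (borel \<Otimes>\<^sub>M borel)"
  shows "(\<integral>\<^sup>+x. H (s \<bullet> x) (orth_part s x) \<partial>lborel)
    = (\<integral>\<^sup>+x. (\<integral>\<^sup>+r. H r (orth_part s x) \<partial>lborel) * ennreal (std_normal_density (s \<bullet> x)) \<partial>lborel)"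
proof -
  let ?\<phi> = "\<lambda>r. ennreal (std_normal_density r)"
  have \<phi>: "(\<integral>\<^sup>+r. ?\<phi> (c - r) \<partial>lborel) = 1" for c
  proof -
    have "(\<integral>\<^sup>+r. ?\<phi> (c - r) \<partial>lborel) = (\<integral>\<^sup>+r. ?\<phi> (- c + r) \<partial>lborel)"
      by (intro nn_integral_cong) (simp add: std_normal_density_def power2_commute)
    also have "\<dots> = 1"
      by (subst nn_integral_lborel_shift) (simp_all add: nn_integral_normal_density)
    finally show ?thesis .
  qed
  have ss: "s \<bullet> s = 1"
    using s by (simp add: norm_eq_1)
  have "(\<integral>\<^sup>+x. H (s \<bullet> x) (orth_part s x) \<partial>lborel)
      = (\<integral>\<^sup>+x. H (s \<bullet> x) (orth_part s x) * (\<integral>\<^sup>+r. ?\<phi> (s \<bullet> x - r) \<partial>lborel) \<partial>lborel)"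
    by (simp add: \<phi>)
  also have "\<dots> = (\<integral>\<^sup>+x. \<integral>\<^sup>+r. H (s \<bullet> x) (orth_part s x) * ?\<phi> (s \<bullet> x - r) \<partial>lborel \<partial>lborel)"
    by (simp add: nn_integral_cmult)
  also have "\<dots> = (\<integral>\<^sup>+r. \<integral>\<^sup>+x. H (s \<bullet> x) (orth_part s x) * ?\<phi> (s \<bullet> x - r) \<partial>lborel \<partial>lborel)"
    by (rule lborel_pair.Fubini'[symmetric]) measurable
  also have "\<dots> = (\<integral>\<^sup>+r. \<integral>\<^sup>+x. H (r + s \<bullet> x) (orth_part s x) * ?\<phi> (s \<bullet> x) \<partial>lborel \<partial>lborel)"
  proof (rule nn_integral_cong)
    fix r :: real
    show "(\<integral>\<^sup>+x. H (s \<bullet> x) (orth_part s x) * ?\<phi> (s \<bullet> x - r) \<partial>lborel)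
      = (\<integral>\<^sup>+x. H (r + s \<bullet> x) (orth_part s x) * ?\<phi> (s \<bullet> x) \<partial>lborel)"
      by (subst nn_integral_lborel_shift[where t = "r *\<^sub>R s", symmetric])
         (simp_all add: orth_part_add orth_part_scaleR orth_part_self[OF s] inner_add_right ss)
  qed
  also have "\<dots> = (\<integral>\<^sup>+x. \<integral>\<^sup>+r. H (r + s \<bullet> x) (orth_part s x) * ?\<phi> (s \<bullet> x) \<partial>lborel \<partial>lborel)"
    by (rule lborel_pair.Fubini') measurable
  also have "\<dots> = (\<integral>\<^sup>+x. (\<integral>\<^sup>+r. H (s \<bullet> x + r) (orth_part s x) \<partial>lborel) * ?\<phi> (s \<bullet> x) \<partial>lborel)"
    by (simp add: nn_integral_multc add.commute)
  also have "\<dots> = (\<integral>\<^sup>+x. (\<integral>\<^sup>+r. H r (orth_part s x) \<partial>lborel) * ?\<phi> (s \<bullet> x) \<partial>lborel)"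
    by (intro nn_integral_cong arg_cong2[where f = "(*)"] nn_integral_lborel_shift) simp_all
  finally show ?thesis .
qed

section \<open>The Gaussian density and its factorization\<close>

text \<open>In the radial form only the norm enters, so by Pythagoras the density factors along any
  unit vector, not just along a coordinate axis.\<close>

lemma std_gaussian_density_eq:
  fixes x :: "real ^ 'n"
  shows "std_gaussian_density x = (1 / sqrt (2 * pi)) ^ CARD('n) * exp (- (norm x)\<^sup>2 / 2)"
proof -
  have "(norm x)\<^sup>2 = (\<Sum>i\<in>UNIV. (x $ i)\<^sup>2)"
    unfolding power2_norm_eq_inner by (simp add: inner_vec_def power2_eq_square)
  then show ?thesis
    by (simp add: std_gaussian_density_def std_normal_density_def prod.distrib exp_sum[symmetric]
        sum_divide_distrib sum_negf power_divide prod_dividef)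
qed

text \<open>The standard Gaussian density of a hyperplane, extended to the whole space by the same
  formula; hence the exponent \<open>CARD('n) - 1\<close>.\<close>

definition orth_density :: "real ^ 'n \<Rightarrow> real" where
  "orth_density x = (1 / sqrt (2 * pi)) ^ (CARD('n) - 1) * exp (- (norm x)\<^sup>2 / 2)"

lemma orth_density_nonneg [simp]: "0 \<le> orth_density x"
  by (simp add: orth_density_def)

lemma borel_measurable_orth_density [measurable]: "orth_density \<in> borel_measurable borel"
  unfolding orth_density_def by measurable

lemma std_gaussian_density_nonneg [simp]: "0 \<le> std_gaussian_density x"
  by (simp add: std_gaussian_density_eq)

lemma borel_measurable_std_gaussian_density [measurable]:
  "std_gaussian_density \<in> borel_measurable borel"
  unfolding std_gaussian_density_eq by measurable

lemma std_gaussian_density_split: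
  fixes s :: "real ^ 'n"
  assumes "norm s = 1"
  shows "std_gaussian_density x = orth_density (orth_part s x) * std_normal_density (s \<bullet> x)"
proof -
  have "CARD('n) = Suc (CARD('n) - 1)"
    by simp
  then have "(1 / sqrt (2 * pi)) ^ CARD('n) = (1 / sqrt (2 * pi)) ^ (CARD('n) - 1) * (1 / sqrt (2 * pi))"
    by (metis power_Suc2)
  moreover have "exp (- (norm x)\<^sup>2 / 2) = exp (- (norm (orth_part s x))\<^sup>2 / 2) * exp (- (s \<bullet> x)\<^sup>2 / 2)"
    unfolding norm_orth_part[OF assms, of x] exp_add[symmetric] by (simp add: field_simps)
  ultimately show ?thesis
    unfolding std_gaussian_density_eq orth_density_def std_normal_density_def by (simp only: mult_ac)
qed

section \<open>Gaussian measure of a translated cone\<close>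

lemma orth_density_shift_le:
  fixes h b :: "real ^ 'n"
  assumes u: "u > 0"
  shows "orth_density (sqrt (1 + u) *\<^sub>R h + b) \<le> exp ((norm b)\<^sup>2 / (2 * u)) * orth_density h"
proof -
  let ?w = "sqrt (1 + u)"
  have w: "?w\<^sup>2 = 1 + u"
    using u by simp
  \<comment> \<open>This square is the slack in the claim: with \<open>w = sqrt (1 + u)\<close>,
    \<open>(norm (u *\<^sub>R h + w *\<^sub>R b))\<^sup>2 / u\<close> equals \<open>(norm (w
    *\<^sub>R h + b))\<^sup>2 - (norm h)\<^sup>2 + (norm b)\<^sup>2 / u\<close>.\<close>
  have "0 \<le> (norm (u *\<^sub>R h + ?w *\<^sub>R b))\<^sup>2 / u"
    using u by simp
  also have "(norm (u *\<^sub>R h + ?w *\<^sub>R b))\<^sup>2 = u\<^sup>2 * (norm h)\<^sup>2 + 2 * u * ?w * (h \<bullet> b) + ?w\<^sup>2 * (norm b)\<^sup>2"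
    unfolding power2_norm_eq_inner by (simp add: inner_add_left inner_add_right inner_commute power2_eq_square algebra_simps)
  also have "\<dots> / u = u * (norm h)\<^sup>2 + 2 * ?w * (h \<bullet> b) + (1 + u) * (norm b)\<^sup>2 / u"
    unfolding w using u by (simp add: field_simps power2_eq_square)
  finally have "0 \<le> u * (norm h)\<^sup>2 + 2 * ?w * (h \<bullet> b) + (norm b)\<^sup>2 / u + (norm b)\<^sup>2"
    using u by (simp add: field_simps)
  moreover have "(norm (?w *\<^sub>R h + b))\<^sup>2 = ?w\<^sup>2 * (norm h)\<^sup>2 + 2 * ?w * (h \<bullet> b) + (norm b)\<^sup>2"
    unfolding power2_norm_eq_inner by (simp add: inner_add_left inner_add_right inner_commute power2_eq_square algebra_simps)
  ultimately have "- (norm (?w *\<^sub>R h + b))\<^sup>2 / 2 \<le> (norm b)\<^sup>2 / (2 * u) + (- (norm h)\<^sup>2 / 2)"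
    unfolding w using u by (simp add: field_simps)
  then have "exp (- (norm (?w *\<^sub>R h + b))\<^sup>2 / 2) \<le> exp ((norm b)\<^sup>2 / (2 * u)) * exp (- (norm h)\<^sup>2 / 2)"
    by (simp add: exp_add[symmetric])
  then show ?thesis
    by (simp add: orth_density_def divide_right_mono)
qed

lemma nn_integral_std_normal_scaled:
  assumes "c > 0"
  shows "(\<integral>\<^sup>+r. ennreal (std_normal_density (c * r)) \<partial>lborel) = ennreal (1 / c)"
proof -
  let ?I = "\<integral>\<^sup>+r. ennreal (std_normal_density (c * r)) \<partial>lborel"
  have "1 = ennreal c * ?I"
    using nn_integral_lborel_affine[of "\<lambda>r. ennreal (std_normal_density r)" c 0] assms
    by (simp add: nn_integral_normal_density)
  then have "ennreal (1 / c) = ennreal (1 / c) * ennreal c * ?I"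
    by (metis mult.assoc mult.right_neutral)
  also have "ennreal (1 / c) * ennreal c = 1"
    using assms by (simp flip: ennreal_mult)
  finally show ?thesis
    by simp
qed

text \<open>Dilation by \<open>c = sqrt (1 + u)\<close> fixes the cone and costs
  \<open>c ^ CARD('n)\<close>. The coordinate along \<open>s\<close> is unaffected by
  \<open>b\<close>, and its scaled density integrates to \<open>1 / c\<close>, which leaves the
  exponent \<open>CARD('n) - 1\<close>.\<close>

lemma std_gaussian_cone_shift:
  fixes s b :: "real ^ 'n" and K :: "(real ^ 'n) set"
  assumes s: "norm s = 1" and sb: "s \<bullet> b = 0" and K [measurable]: "K \<in> sets borel" and "cone K"
  shows "(\<integral>\<^sup>+x. indicator K (orth_part s x) * ennreal (std_gaussian_density (x + b)) \<partial>lborel)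
    \<le> ennreal (exp (norm b * sqrt (real CARD('n) - 1)))
       * (\<integral>\<^sup>+x. indicator K (orth_part s x) * ennreal (std_gaussian_density x) \<partial>lborel)"
proof (cases "b = 0")
  case True
  then show ?thesis by simp
next
  case False
  define d where "d = real CARD('n) - 1"
  \<comment> \<open>On a line, \<open>s \<bullet> b = 0\<close> with \<open>s\<close> nonzero would
    force \<open>b = 0\<close>. So \<open>d\<close> is positive and division by
    \<open>sqrt d\<close> is legitimate.\<close>
  have "CARD('n) \<noteq> 1"
  proof
    assume "CARD('n) = 1"
    then obtain k where k: "(UNIV :: 'n set) = {k}"
      by (rule card_1_singletonE)
    then have "x = 0 \<longleftrightarrow> x $ k = 0" for x :: "real ^ 'n"
      by (metis vec_eq_iff singletonD UNIV_I zero_index)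
    moreover have "s $ k * b $ k = 0"
      using sb by (simp add: inner_vec_def k)
    ultimately show False
      using s False by (metis mult_eq_0_iff norm_zero zero_neq_one)
  qed
  then have "CARD('n) > 1"
    by (metis One_nat_def less_one linorder_neqE_nat zero_less_card_finite less_irrefl)
  then have d: "d > 0" "d = real (CARD('n) - 1)"
    by (auto simp: d_def)
  \<comment> \<open>This value minimizes \<open>d * u / 2 + (norm b)\<^sup>2 / (2 * u)\<close>, the
    exponent reached at the end; both summands then equal
    \<open>norm b * sqrt d / 2\<close>.\<close>
  define u where "u = norm b / sqrt d"
  have u: "u > 0"
    using d False by (simp add: u_def)
  define c where "c = sqrt (1 + u)"
  have c: "c > 0" "c\<^sup>2 = 1 + u"
    using u by (auto simp: c_def)
  have cK: "c *\<^sub>R y \<in> K \<longleftrightarrow> y \<in> K" for y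
  proof -
    have "y \<in> K" if "c *\<^sub>R y \<in> K"
    proof -
      have "(1 / c) *\<^sub>R (c *\<^sub>R y) \<in> K"
        using that c(1) by (intro mem_cone[OF \<open>cone K\<close>, of "c *\<^sub>R y"]) auto
      with c(1) show ?thesis by simp
    qed
    then show ?thesis
      using mem_cone[OF \<open>cone K\<close>, of y c] c(1) by auto
  qed
  have ob: "orth_part s b = b"
    using sb by (rule orth_part_eq)
  let ?E = "exp ((norm b)\<^sup>2 / (2 * u))"
  let ?G = "\<lambda>x. indicator K (orth_part s x) * ennreal (std_gaussian_density x)"
  have "(\<integral>\<^sup>+x. indicator K (orth_part s x) * ennreal (std_gaussian_density (x + b)) \<partial>lborel)
      = ennreal (c ^ CARD('n)) * (\<integral>\<^sup>+x. indicator K (orth_part s (c *\<^sub>R x)) * ennreal (std_gaussian_density (c *\<^sub>R x + b)) \<partial>lborel)"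
    using nn_integral_lborel_affine[of "\<lambda>x. indicator K (orth_part s x) * ennreal (std_gaussian_density (x + b))" c 0] c(1)
    by (simp add: comp_def)
  also have "\<dots> \<le> ennreal (c ^ CARD('n)) * (\<integral>\<^sup>+x. ennreal ?E * (indicator K (orth_part s x) *
      ennreal (orth_density (orth_part s x)) * ennreal (std_normal_density (c * (s \<bullet> x)))) \<partial>lborel)"
  proof (intro mult_left_mono nn_integral_mono)
    fix x :: "real ^ 'n"
    have "std_gaussian_density (c *\<^sub>R x + b)
        = orth_density (c *\<^sub>R orth_part s x + b) * std_normal_density (c * (s \<bullet> x))"
      unfolding std_gaussian_density_split[OF s]
      by (simp add: orth_part_add orth_part_scaleR ob sb inner_add_right)
    also have "\<dots> \<le> (?E * orth_density (orth_part s x)) * std_normal_density (c * (s \<bullet> x))"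
      unfolding c_def using u by (intro mult_right_mono orth_density_shift_le) auto
    finally have "ennreal (std_gaussian_density (c *\<^sub>R x + b))
        \<le> ennreal ?E * ennreal (orth_density (orth_part s x)) * ennreal (std_normal_density (c * (s \<bullet> x)))"
      by (simp flip: ennreal_mult)
    then show "indicator K (orth_part s (c *\<^sub>R x)) * ennreal (std_gaussian_density (c *\<^sub>R x + b))
        \<le> ennreal ?E * (indicator K (orth_part s x) *
      ennreal (orth_density (orth_part s x)) * ennreal (std_normal_density (c * (s \<bullet> x))))"
      by (auto simp: orth_part_scaleR cK mult.assoc split: split_indicator)
  qed simp
  also have "(\<integral>\<^sup>+x. ennreal ?E * (indicator K (orth_part s x) *
      ennreal (orth_density (orth_part s x)) * ennreal (std_normal_density (c * (s \<bullet> x)))) \<partial>lborel)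
     = ennreal ?E * (\<integral>\<^sup>+x. indicator K (orth_part s x) *
      ennreal (orth_density (orth_part s x)) * ennreal (std_normal_density (c * (s \<bullet> x))) \<partial>lborel)"
    by (rule nn_integral_cmult) measurable
  also have "(\<integral>\<^sup>+x. indicator K (orth_part s x) *
      ennreal (orth_density (orth_part s x)) * ennreal (std_normal_density (c * (s \<bullet> x))) \<partial>lborel)
    = (\<integral>\<^sup>+x. ennreal (1 / c) * ?G x \<partial>lborel)"
  proof -
    have "(\<integral>\<^sup>+r. indicator K y * ennreal (orth_density y) * ennreal (std_normal_density (c * r)) \<partial>lborel)
        = indicator K y * ennreal (orth_density y) * ennreal (1 / c)" for y
      by (subst nn_integral_cmult) (simp_all only: nn_integral_std_normal_scaled[OF c(1)], measurable)
    then show ?thesis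
      using nn_integral_split_direction[OF s, where H = "\<lambda>r y. indicator K y *
        ennreal (orth_density y) * ennreal (std_normal_density (c * r))"]
      by (simp add: std_gaussian_density_split[OF s] ennreal_mult mult_ac)
  qed
  also have "\<dots> = ennreal (1 / c) * (\<integral>\<^sup>+x. ?G x \<partial>lborel)"
    by (rule nn_integral_cmult) measurable
  also have "ennreal (c ^ CARD('n)) * (ennreal ?E * \<dots>)
      = ennreal (c ^ CARD('n) * ?E * (1 / c)) * (\<integral>\<^sup>+x. ?G x \<partial>lborel)"
    using c(1) by (intro ennreal_mult3) auto
  also have "\<dots> \<le> ennreal (exp (norm b * sqrt d)) * (\<integral>\<^sup>+x. ?G x \<partial>lborel)"
  proof (intro mult_right_mono ennreal_leI)
    \<comment> \<open>From \<open>1 + u \<le> exp u\<close>: the dilation cost becomes an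
      exponential too, and the two exponents add.\<close>
    have "c \<le> exp (u / 2)"
    proof (rule power2_le_imp_le)
      show "c\<^sup>2 \<le> (exp (u / 2))\<^sup>2"
        unfolding c(2) using exp_ge_add_one_self[of u] by (simp flip: exp_double)
    qed simp
    then have "c ^ (CARD('n) - 1) \<le> exp (u / 2) ^ (CARD('n) - 1)"
      using c(1) by (intro power_mono) auto
    also have "\<dots> = exp (d * u / 2)"
      using d(2) by (simp flip: exp_of_nat_mult)
    finally have c1: "c ^ (CARD('n) - 1) \<le> exp (d * u / 2)" .
    have "c ^ CARD('n) * ?E * (1 / c) = c ^ (CARD('n) - 1) * ?E"
      using c(1) \<open>CARD('n) > 1\<close> by (simp add: power_eq_if)
    also have "\<dots> \<le> exp (d * u / 2) * ?E"
      using c1 by (intro mult_right_mono) auto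
    also have "\<dots> = exp (d * u / 2 + (norm b)\<^sup>2 / (2 * u))"
      by (simp add: exp_add)
    also have "d * u / 2 + (norm b)\<^sup>2 / (2 * u) = norm b * sqrt d"
    proof -
      have "d * u / 2 = norm b * sqrt d / 2"
        using d(1) by (simp add: u_def field_simps)
      moreover have "(norm b)\<^sup>2 / (2 * u) = norm b * sqrt d / 2"
        using d(1) False by (simp add: u_def field_simps power2_eq_square)
      ultimately show ?thesis
        by simp
    qed
    finally show "c ^ CARD('n) * ?E * (1 / c) \<le> exp (norm b * sqrt d)" .
  qed simp
  finally show ?thesis
    by (simp add: d_def)
qed

section \<open>Hyperplanes and projections under the Gaussian measure\<close>

lemma emeasure_std_gaussian:
  assumes "A \<in> sets borel"
  shows "emeasure std_gaussian A = (\<integral>\<^sup>+x. indicator A x * ennreal (std_gaussian_density x) \<partial>lborel)"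
  unfolding std_gaussian_def using assms by (subst emeasure_density) (auto simp: mult.commute)

lemma sets_std_gaussian [measurable_cong, simp]: "sets std_gaussian = sets borel"
  by (simp add: std_gaussian_def)

lemma std_gaussian_hyperplane:
  fixes w :: "real ^ 'n"
  assumes "w \<noteq> 0"
  shows "emeasure std_gaussian {x. w \<bullet> x = 0} = 0"
proof -
  have m: "{x. w \<bullet> x = 0} \<in> sets borel"
    by (intro borel_closed closed_hyperplane)
  have "{x. w \<bullet> x = 0} \<in> null_sets lebesgue"
    using assms negligible_hyperplane[of w 0] by (simp add: negligible_iff_null_sets)
  then have "{x. w \<bullet> x = 0} \<in> null_sets lborel"
    using m by (auto simp: null_sets_def)
  then have "AE x in lborel. w \<bullet> x \<noteq> 0"
    by (rule AE_I') auto
  then have "(\<integral>\<^sup>+x. indicator {x. w \<bullet> x = 0} x * ennreal (std_gaussian_density x) \<partial>lborel)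
      = (\<integral>\<^sup>+(x :: real ^ 'n). 0 \<partial>lborel)"
    by (intro nn_integral_cong_AE) (auto split: split_indicator)
  then show ?thesis
    using m by (simp add: emeasure_std_gaussian)
qed

lemma borel_vimage_orth_part: "K \<in> sets borel \<Longrightarrow> {x. orth_part s x \<in> K} \<in> sets borel"
  using measurable_sets_borel[OF borel_measurable_orth_part[of s], of K] by (simp add: vimage_def)

text \<open>Equality of \<open>span K\<close> with the hyperplane is not needed: if the span is smaller, the left-hand
  side is the measure of a subset of another hyperplane.\<close>

lemma std_gaussian_orth_part_le:
  fixes s :: "real ^ 'n"
  assumes s: "norm s = 1" and K: "closed K" "K \<subseteq> {v. s \<bullet> v = 0}"
  shows "emeasure std_gaussian {x. orth_part s x \<in> K}
    \<le> emeasure std_gaussian {x. closest_point (span K) x \<in> K}"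
proof (cases "span K = {v. s \<bullet> v = 0}")
  case True
  \<comment> \<open>The distance from \<open>x\<close> to \<open>orth_part s x\<close> is
    \<open>\<bar>s \<bullet> x\<bar>\<close>, and by Cauchy-Schwarz no point of the hyperplane is
    closer.\<close>
  have "closest_point (span K) x = orth_part s x" for x
  proof (rule closest_point_unique[symmetric])
    show "orth_part s x \<in> span K"
      by (simp add: True inner_orth_part[OF s])
    show "\<forall>z\<in>span K. dist x (orth_part s x) \<le> dist x z"
    proof
      fix z assume "z \<in> span K"
      then have "s \<bullet> (x - z) = s \<bullet> x"
        by (simp add: True inner_diff_right)
      then have "\<bar>s \<bullet> x\<bar> \<le> norm (x - z)"
        using Cauchy_Schwarz_ineq2[of s "x - z"] s by simp
      then show "dist x (orth_part s x) \<le> dist x z"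
        by (simp add: dist_norm orth_part_def s)
    qed
  qed (simp_all add: subspace_imp_convex closed_subspace)
  then show ?thesis by simp
next
  case False
  have sub: "subspace {v. s \<bullet> v = 0}"
    by (rule subspace_hyperplane)
  with K(2) False have "span K \<subset> span {v. s \<bullet> v = 0}"
    by (metis psubsetI span_eq_iff span_minimal)
  \<comment> \<open>The vector \<open>w\<close> is orthogonal to \<open>K\<close> and, lying in the
    hyperplane, also to \<open>s\<close>. Removing the \<open>s\<close>-component of
    \<open>x\<close> therefore leaves \<open>w \<bullet> x\<close> unchanged.\<close>
  then obtain w where w: "w \<noteq> 0" "w \<in> span {v. s \<bullet> v = 0}" "\<And>y. y \<in> span K \<Longrightarrow> orthogonal w y"
    by (rule orthogonal_to_subspace_exists_gen) blast
  then have sw: "s \<bullet> w = 0"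
    using sub by (metis mem_Collect_eq span_eq_iff)
  have "w \<bullet> x = 0" if "orth_part s x \<in> K" for x
  proof -
    have "w \<bullet> orth_part s x = 0"
      using w(3)[OF span_base[OF that]] by (simp add: orthogonal_def)
    then show ?thesis
      using sw by (simp add: orth_part_def inner_diff_right inner_commute)
  qed
  then have "emeasure std_gaussian {x. orth_part s x \<in> K} \<le> emeasure std_gaussian {x. w \<bullet> x = 0}"
    by (intro emeasure_mono) (auto intro!: borel_closed closed_hyperplane)
  also have "\<dots> = 0"
    by (rule std_gaussian_hyperplane) fact
  finally show ?thesis by simp
qed

section \<open>The Gaussian measure swept out by a moving cone\<close>

text \<open>Bounds the chance that the segment from \<open>x\<close> to
  \<open>x - \<epsilon> *\<^sub>R p\<close> meets \<open>K\<close>. Stating it through a Borel cover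
  \<open>B\<close> supplies a measurable set for the union bound over edges.\<close>

lemma std_gaussian_sweep_le:
  fixes s p :: "real ^ 'n" and K :: "(real ^ 'n) set"
  assumes s: "norm s = 1" and K: "closed K" "cone K" "K \<subseteq> {v. s \<bullet> v = 0}" and e: "\<epsilon> \<ge> 0"
  obtains B where "B \<in> sets borel" "\<And>t x. t \<in> {0..\<epsilon>} \<Longrightarrow> x - t *\<^sub>R p \<in> K \<Longrightarrow> x \<in> B"
    "emeasure std_gaussian B \<le> ennreal (1 / sqrt (2 * pi) * (\<epsilon> * \<bar>s \<bullet> p\<bar>) * exp (\<epsilon> * sqrt (real CARD('n) - 1) * norm p))
      * emeasure std_gaussian {x. closest_point (span K) x \<in> K}"
proof (cases "s \<bullet> p = 0")
  \<comment> \<open>All translates stay in one null hyperplane, matching the factor zero on the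
    right.\<close>
  case True
  show thesis
  proof
    show "{x. s \<bullet> x = 0} \<in> sets borel"
      by (intro borel_closed closed_hyperplane)
    show "x \<in> {x. s \<bullet> x = 0}" if "t \<in> {0..\<epsilon>}" "x - t *\<^sub>R p \<in> K" for t x
      using that True K(3) by (auto simp: inner_diff_right)
    show "emeasure std_gaussian {x. s \<bullet> x = 0} \<le> ennreal (1 / sqrt (2 * pi) * (\<epsilon> * \<bar>s \<bullet> p\<bar>) * exp (\<epsilon> * sqrt (real CARD('n) - 1) * norm p))
      * emeasure std_gaussian {x. closest_point (span K) x \<in> K}"
      using s by (subst std_gaussian_hyperplane) auto
  qed
next
  case False
  define a where "a = s \<bullet> p"
  define q where "q = orth_part s p"
  have a: "a \<noteq> 0"
    using False by (simp add: a_def)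
  have sq: "s \<bullet> q = 0"
    by (simp add: q_def inner_orth_part[OF s])
  have p: "p = a *\<^sub>R s + q"
    by (simp add: a_def q_def orth_part_def)
  have [measurable]: "K \<in> sets borel"
    using K(1) by (rule borel_closed)
  \<comment> \<open>If \<open>x - t *\<^sub>R p \<in> K\<close>, then
    \<open>s \<bullet> x = t * a\<close>. Substituting \<open>t = (s \<bullet> x) / a\<close>
    eliminates the parameter and leaves a condition on the two components of
    \<open>x\<close>.\<close>
  let ?B = "{x. (s \<bullet> x) / a \<in> {0..\<epsilon>} \<and> orth_part s x - ((s \<bullet> x) / a) *\<^sub>R q \<in> K}"
  let ?G = "\<integral>\<^sup>+x. indicator K (orth_part s x) * ennreal (std_gaussian_density x) \<partial>lborel"
  let ?E = "exp (\<epsilon> * sqrt (real CARD('n) - 1) * norm p)"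
  let ?H = "\<lambda>r y. ennreal (std_normal_density r) * indicator {0..\<epsilon>} (r / a) *
    (indicator K (y - (r / a) *\<^sub>R q) * ennreal (orth_density y))"
  have Bm: "?B \<in> sets borel"
  proof -
    have "{x \<in> space borel. (s \<bullet> x) / a \<in> {0..\<epsilon>} \<and> orth_part s x - ((s \<bullet> x) / a) *\<^sub>R q \<in> K} \<in> sets borel"
      by measurable
    then show ?thesis by simp
  qed
  \<comment> \<open>For a fixed parameter, translating by \<open>t *\<^sub>R q\<close>, which lies
    in the hyperplane, moves the offset from the cone to the density. The shift bound applies, and
    \<open>norm q \<le> norm p\<close>.\<close>
  have inner: "(\<integral>\<^sup>+x. indicator K (orth_part s x - t *\<^sub>R q) * ennreal (std_gaussian_density x) \<partial>lborel)
      \<le> ennreal ?E * ?G" if t: "t \<in> {0..\<epsilon>}" for t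
  proof -
    have "(\<integral>\<^sup>+x. indicator K (orth_part s x - t *\<^sub>R q) * ennreal (std_gaussian_density x) \<partial>lborel)
        = (\<integral>\<^sup>+x. indicator K (orth_part s x) * ennreal (std_gaussian_density (x + t *\<^sub>R q)) \<partial>lborel)"
      by (subst nn_integral_lborel_shift[where t = "t *\<^sub>R q", symmetric])
         (simp_all add: orth_part_add orth_part_scaleR orth_part_eq[OF sq] add.commute)
    also have "\<dots> \<le> ennreal (exp (norm (t *\<^sub>R q) * sqrt (real CARD('n) - 1))) * ?G"
      by (rule std_gaussian_cone_shift[OF s _ _ K(2)]) (simp_all add: sq)
    also have "\<dots> \<le> ennreal ?E * ?G"
    proof (intro mult_right_mono ennreal_leI)
      have "norm (t *\<^sub>R q) \<le> \<epsilon> * norm p"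
        using t norm_orth_part_le[OF s, of p] by (auto simp: q_def intro!: mult_mono)
      then have "norm (t *\<^sub>R q) * sqrt (real CARD('n) - 1) \<le> \<epsilon> * norm p * sqrt (real CARD('n) - 1)"
        by (intro mult_right_mono) (auto simp: Suc_le_eq)
      then show "exp (norm (t *\<^sub>R q) * sqrt (real CARD('n) - 1)) \<le> ?E"
        by (simp add: mult_ac)
    qed simp
    finally show ?thesis .
  qed
  have "emeasure std_gaussian ?B = (\<integral>\<^sup>+x. ?H (s \<bullet> x) (orth_part s x) \<partial>lborel)"
    unfolding emeasure_std_gaussian[OF Bm]
    by (intro nn_integral_cong)
       (auto simp: std_gaussian_density_split[OF s] ennreal_mult mult_ac split: split_indicator)
  also have "\<dots> = (\<integral>\<^sup>+x. (\<integral>\<^sup>+r. ?H r (orth_part s x) \<partial>lborel) * ennreal (std_normal_density (s \<bullet> x)) \<partial>lborel)"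
    by (rule nn_integral_split_direction[OF s]) measurable
  \<comment> \<open>The auxiliary factor \<open>std_normal_density (s \<bullet> x)\<close> is pulled
    inside: once \<open>r\<close> is fixed, it completes \<open>orth_density\<close> to the full
    Gaussian density, as \<open>inner\<close> requires.\<close>
  also have "\<dots> = (\<integral>\<^sup>+x. \<integral>\<^sup>+r. ?H r (orth_part s x) * ennreal (std_normal_density (s \<bullet> x)) \<partial>lborel \<partial>lborel)"
    by (intro nn_integral_cong nn_integral_multc[symmetric]) measurable
  also have "\<dots> = (\<integral>\<^sup>+r. \<integral>\<^sup>+x. ?H r (orth_part s x) * ennreal (std_normal_density (s \<bullet> x)) \<partial>lborel \<partial>lborel)"
    by (rule lborel_pair.Fubini'[symmetric]) measurable
  also have "\<dots> \<le> (\<integral>\<^sup>+r. ennreal (1 / sqrt (2 * pi)) * (ennreal ?E * ?G) * indicator {0..\<epsilon>} (r / a) \<partial>lborel)"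
  proof (rule nn_integral_mono)
    fix r :: real
    let ?c = "ennreal (std_normal_density r) * indicator {0..\<epsilon>} (r / a)"
    have "(\<integral>\<^sup>+x. ?H r (orth_part s x) * ennreal (std_normal_density (s \<bullet> x)) \<partial>lborel)
        = (\<integral>\<^sup>+x. ?c * (indicator K (orth_part s x - (r / a) *\<^sub>R q) * ennreal (std_gaussian_density x)) \<partial>lborel)"
      by (intro nn_integral_cong) (simp add: std_gaussian_density_split[OF s] ennreal_mult mult_ac)
    also have "\<dots> = ?c * (\<integral>\<^sup>+x. indicator K (orth_part s x - (r / a) *\<^sub>R q) * ennreal (std_gaussian_density x) \<partial>lborel)"
      by (rule nn_integral_cmult) measurable
    also have "\<dots> \<le> ennreal (1 / sqrt (2 * pi)) * indicator {0..\<epsilon>} (r / a) * (ennreal ?E * ?G)"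
    proof (cases "r / a \<in> {0..\<epsilon>}")
      case True
      then show ?thesis
        by (intro mult_mono inner ennreal_leI) (auto simp: std_normal_density_def field_simps)
    next
      case False
      then show ?thesis by simp
    qed
    finally show "(\<integral>\<^sup>+x. ?H r (orth_part s x) * ennreal (std_normal_density (s \<bullet> x)) \<partial>lborel)
        \<le> ennreal (1 / sqrt (2 * pi)) * (ennreal ?E * ?G) * indicator {0..\<epsilon>} (r / a)"
      by (simp add: mult_ac)
  qed
  also have "\<dots> = ennreal (1 / sqrt (2 * pi)) * (ennreal ?E * ?G) * (\<integral>\<^sup>+r. indicator {0..\<epsilon>} (r / a) \<partial>lborel)"
    by (rule nn_integral_cmult) measurable
  \<comment> \<open>Substituting \<open>r = a * t\<close> handles both signs of \<open>a\<close>;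
    the interval has length \<open>\<epsilon> * \<bar>a\<bar>\<close>.\<close>
  also have "(\<integral>\<^sup>+r. indicator {0..\<epsilon>} (r / a) \<partial>lborel) = ennreal (\<epsilon> * \<bar>a\<bar>)"
    using a e by (subst nn_integral_lborel_affine[where c = a and t = 0])
      (simp_all add: ennreal_mult mult.commute)
  also have "ennreal (1 / sqrt (2 * pi)) * (ennreal ?E * ?G) * ennreal (\<epsilon> * \<bar>a\<bar>)
      = ennreal (1 / sqrt (2 * pi)) * (ennreal (\<epsilon> * \<bar>a\<bar>) * (ennreal ?E * ?G))"
    by (simp only: mult_ac)
  also have "\<dots> = ennreal (1 / sqrt (2 * pi) * (\<epsilon> * \<bar>a\<bar>) * ?E) * ?G"
    using e by (intro ennreal_mult3) auto
  also have "?G = emeasure std_gaussian {x. orth_part s x \<in> K}"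
    by (simp add: emeasure_std_gaussian borel_vimage_orth_part indicator_def)
  also have "ennreal (1 / sqrt (2 * pi) * (\<epsilon> * \<bar>a\<bar>) * ?E) * \<dots>
    \<le> ennreal (1 / sqrt (2 * pi) * (\<epsilon> * \<bar>a\<bar>) * ?E) * emeasure std_gaussian {x. closest_point (span K) x \<in> K}"
    by (intro mult_left_mono std_gaussian_orth_part_le s K) simp
  finally have le: "emeasure std_gaussian ?B
    \<le> ennreal (1 / sqrt (2 * pi) * (\<epsilon> * \<bar>s \<bullet> p\<bar>) * ?E) * emeasure std_gaussian {x. closest_point (span K) x \<in> K}"
    by (simp only: a_def)
  have mem: "x \<in> ?B" if "t \<in> {0..\<epsilon>}" "x - t *\<^sub>R p \<in> K" for t x
  proof -
    have "s \<bullet> (x - t *\<^sub>R p) = 0"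
      using that(2) K(3) by auto
    then have t: "s \<bullet> x = t * a"
      by (simp add: inner_diff_right a_def)
    then have "orth_part s x - t *\<^sub>R q = x - t *\<^sub>R p"
      by (simp add: orth_part_def p algebra_simps)
    with that t a show ?thesis by simp
  qed
  show thesis
    using Bm mem le by (rule that)
qed

section \<open>Optimal faces and failure of exact regularization\<close>

text \<open>The face of \<open>Q\<close> exposed by \<open>v\<close>. Both programs become
  instances, with \<open>v = g\<close> and \<open>v = g - \<epsilon> *\<^sub>R p\<close>.\<close>

definition maximizers :: "'a::real_inner set \<Rightarrow> 'a \<Rightarrow> 'a set" where
  "maximizers Q v = {x \<in> Q. \<forall>y\<in>Q. v \<bullet> y \<le> v \<bullet> x}"

lemma maximizers_nonempty:
  assumes "compact Q" "Q \<noteq> {}"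
  shows "maximizers Q v \<noteq> {}"
proof -
  have "continuous_on Q (\<lambda>x. v \<bullet> x)"
    by (intro continuous_intros)
  from continuous_attains_sup[OF assms this] show ?thesis
    by (auto simp: maximizers_def)
qed

lemma maximizers_face_of:
  fixes Q :: "'a::euclidean_space set"
  assumes "convex Q"
  shows "maximizers Q v face_of Q"
proof (cases "maximizers Q v = {}")
  case False
  then obtain x where x: "x \<in> maximizers Q v"
    by auto
  then have "maximizers Q v = Q \<inter> {y. v \<bullet> y = v \<bullet> x}"
    by (force simp: maximizers_def intro: antisym)
  then show ?thesis
    using assms x by (auto simp: maximizers_def intro: face_of_Int_supporting_hyperplane_le)
qed auto

lemma lp_solution_iff: "lp_solution Q g z \<longleftrightarrow> z \<in> maximizers Q g"
  by (auto simp: lp_solution_def is_arg_min_linorder maximizers_def)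

lemma perturbed_solution_iff:
  "perturbed_solution Q (\<lambda>x. p \<bullet> x) \<epsilon> g z \<longleftrightarrow> z \<in> maximizers Q (g - \<epsilon> *\<^sub>R p)"
  by (auto simp: perturbed_solution_def is_arg_min_linorder maximizers_def inner_diff_left)

text \<open>Passing to a facet lowers the dimension by exactly one, so repeated descent stops at
  dimension one.\<close>

lemma polytope_edge_exists:
  fixes P :: "'a::euclidean_space set"
  assumes "polytope P" "aff_dim P \<ge> 1"
  shows "\<exists>e. e edge_of P"
  using assms
proof (induction "nat (aff_dim P)" arbitrary: P rule: less_induct)
  case less
  show ?case
  proof (cases "aff_dim P = 1")
    case True
    then show ?thesis
      using less.prems(1) by (auto simp: edge_of_def polytope_imp_convex intro!: exI[of _ P] face_of_refl)
  next
    case False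
    with less.prems obtain F where F: "F facet_of P"
      using polytope_facet_exists[of P] by auto
    then have "polytope F" "aff_dim F = aff_dim P - 1" "F face_of P"
      using less.prems(1) by (auto simp: facet_of_def face_of_polytope_polytope)
    moreover have "nat (aff_dim P - 1) < nat (aff_dim P)" "aff_dim P - 1 \<ge> 1"
      using less.prems(2) False by linarith+
    ultimately obtain e where "e edge_of F"
      using less.hyps[of F] by auto
    then show ?thesis
      using \<open>F face_of P\<close> by (auto simp: edge_of_def intro: face_of_trans)
  qed
qed

text \<open>Two maximizers make the optimal face at least one-dimensional, so it contains an edge. A
  relative interior point of that edge maximizes \<open>v\<close>, which places \<open>v\<close> in
  the normal cone.\<close>

lemma mem_face_normal_cone_of_two_maximizers:
  fixes Q :: "(real ^ 'n) set"
  assumes Q: "polytope Q" and xy: "x \<in> maximizers Q v" "y \<in> maximizers Q v" "x \<noteq> y"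
  obtains f where "f edge_of Q" "v \<in> face_normal_cone Q f"
proof -
  let ?F = "maximizers Q v"
  have face: "?F face_of Q"
    by (intro maximizers_face_of polytope_imp_convex Q)
  have "?F \<noteq> {}" "\<nexists>a. ?F = {a}"
    using xy by auto
  then have "\<not> aff_dim ?F < 0" "aff_dim ?F \<noteq> 0"
    unfolding aff_dim_negative_iff aff_dim_eq_0 by blast+
  then have "aff_dim ?F \<ge> 1"
    by linarith
  then obtain f where f: "f edge_of ?F"
    using polytope_edge_exists face_of_polytope_polytope[OF Q face] by blast
  then have fQ: "f edge_of Q"
    using face by (auto simp: edge_of_def intro: face_of_trans)
  then have "convex f" "f \<noteq> {}"
    by (auto simp: edge_of_def face_of_imp_convex)
  then obtain z where z: "z \<in> rel_interior f"
    using rel_interior_eq_empty by blast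
  then have "z \<in> ?F"
    using rel_interior_subset edge_of_imp_subset[OF f] by blast
  then have "v \<in> normal_cone Q z"
    by (auto simp: normal_cone_def maximizers_def inner_diff_right)
  also have "normal_cone Q z = face_normal_cone Q f"
    using face_normal_cone_eq[OF polytope_imp_convex[OF Q] _ z] fQ by (simp add: edge_of_def)
  finally show thesis
    using fQ that by blast
qed

text \<open>If the maximizer stayed unique along the segment from \<open>g\<close> to \<open>g - \<epsilon> p\<close>, then the parameter
  interval would be partitioned into finitely many closed sets indexed by vertices, so by
  connectedness the maximizer would not change.\<close>

lemma not_exact_regularization_imp:
  fixes Q :: "(real ^ 'n) set"
  assumes Q: "polytope Q" "Q \<noteq> {}" and e: "\<epsilon> \<ge> 0"
    and not_ER: "\<not> exact_regularization Q (\<lambda>x. p \<bullet> x) \<epsilon> g"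
  obtains t f where "t \<in> {0..\<epsilon>}" "f edge_of Q" "g - t *\<^sub>R p \<in> face_normal_cone Q f"
proof -
  let ?F = "\<lambda>t. maximizers Q (g - t *\<^sub>R p)"
  have "\<exists>t\<in>{0..\<epsilon>}. \<exists>x y. x \<in> ?F t \<and> y \<in> ?F t \<and> x \<noteq> y"
  proof (rule ccontr)
    assume "\<not> ?thesis"
    then have uniq: "x = y" if "t \<in> {0..\<epsilon>}" "x \<in> ?F t" "y \<in> ?F t" for t x y
      using that by blast
    obtain V where V: "finite V" "Q = convex hull V"
      using Q(1) by (auto simp: polytope_def)
    \<comment> \<open>A unique maximizer belongs to the finite generating set \<open>V\<close>, so
      finitely many sets \<open>T v\<close> cover the interval.\<close>
    have ex: "\<exists>v\<in>V. v \<in> ?F t" if t: "t \<in> {0..\<epsilon>}" for t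
    proof -
      obtain v where v: "v \<in> ?F t"
        using maximizers_nonempty[OF polytope_imp_compact[OF Q(1)] Q(2)] by blast
      then have "lp_solution Q (g - t *\<^sub>R p) v \<and> (\<exists>!z. lp_solution Q (g - t *\<^sub>R p) z)"
        using uniq[OF t] unfolding lp_solution_iff by blast
      then have "v \<in> V"
        using unique_lp_solution_convex_hull[OF V(1)] V(2) by blast
      with v show ?thesis by blast
    qed
    obtain z where z: "z \<in> ?F 0"
      using ex[of 0] e by auto
    define T where "T v = {t. v \<in> ?F t}" for v
    have closed_T: "closed (T v)" for v
    proof (cases "v \<in> Q")
      case True
      then have "T v = (\<Inter>y\<in>Q. {t. (g - t *\<^sub>R p) \<bullet> y \<le> (g - t *\<^sub>R p) \<bullet> v})"
        by (auto simp: T_def maximizers_def)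
      then show ?thesis
        by (auto intro!: closed_INT closed_Collect_le continuous_intros)
    next
      case False
      then show ?thesis
        by (simp add: T_def maximizers_def)
    qed
    let ?B = "\<Union>v\<in>V - {z}. T v"
    have "closed ?B"
      using V(1) closed_T by blast
    moreover have cover: "{0..\<epsilon>} \<subseteq> T z \<union> ?B"
      using ex unfolding T_def by blast
    moreover have "T z \<inter> ?B \<inter> {0..\<epsilon>} = {}"
      using uniq by (auto simp: T_def)
    moreover have "T z \<inter> {0..\<epsilon>} \<noteq> {}"
    proof -
      have "0 \<in> T z \<inter> {0..\<epsilon>}"
        using z e by (simp add: T_def)
      then show ?thesis by blast
    qed
    \<comment> \<open>The closed sets \<open>T z\<close> and \<open>?B\<close> cover the connected
      interval and are disjoint on it; since \<open>0 \<in> T z\<close>, the other one misses the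
      interval.\<close>
    ultimately have "?B \<inter> {0..\<epsilon>} = {}"
      using connected_closedD[OF connected_Icc[of 0 \<epsilon>] _ _ closed_T[of z]] by metis
    moreover have "\<epsilon> \<in> {0..\<epsilon>}"
      using e by simp
    ultimately have "\<epsilon> \<in> T z"
      using cover by blast
    then have "perturbed_solution Q (\<lambda>x. p \<bullet> x) \<epsilon> g z"
      by (simp add: perturbed_solution_iff T_def)
    moreover have "lp_solution Q g x \<longleftrightarrow> x = z" for x
      using z uniq[of 0] e by (auto simp: lp_solution_iff)
    ultimately have "exact_regularization Q (\<lambda>x. p \<bullet> x) \<epsilon> g"
      by (simp add: exact_regularization_def)
    with not_ER show False by blast
  qed
  then obtain t where t: "t \<in> {0..\<epsilon>}" "\<exists>x y. x \<in> ?F t \<and> y \<in> ?F t \<and> x \<noteq> y"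
    by (rule bexE)
  from t(2) obtain x y where xy: "x \<in> ?F t" "y \<in> ?F t" "x \<noteq> y"
    by (elim exE conjE)
  obtain f where "f edge_of Q" "g - t *\<^sub>R p \<in> face_normal_cone Q f"
    by (rule mem_face_normal_cone_of_two_maximizers[OF Q(1) xy])
  with t(1) show thesis
    by (rule that)
qed

section \<open>Normal cones of edges and the union bound\<close>

lemma cone_normal_cone: "cone (normal_cone Q x)"
  by (auto simp: cone_def normal_cone_def mult_nonneg_nonpos)

text \<open>A linear functional that attains its maximum at a relative interior point of
  \<open>f\<close> is constant on \<open>f\<close>: the segment from any point of \<open>f\<close>
  to \<open>z\<close> can be prolonged beyond \<open>z\<close> within \<open>f\<close>. This puts
  the normal cone of an edge into the hyperplane orthogonal to it.\<close>

lemma normal_cone_orthogonal_face: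
  fixes Q :: "(real ^ 'n) set"
  assumes "convex f" "f \<subseteq> Q" "z \<in> rel_interior f" "v \<in> normal_cone Q z"
    and u: "u \<in> span {x - y |x y. x \<in> f \<and> y \<in> f}"
  shows "u \<bullet> v = 0"
proof -
  have const: "v \<bullet> x = v \<bullet> z" if x: "x \<in> f" for x
  proof -
    have "x \<in> affine hull f"
      using x by (rule hull_inc)
    then obtain e where e: "e > 1" "(1 - e) *\<^sub>R x + e *\<^sub>R z \<in> f"
      using bspec[OF convex_rel_interior_if2[OF assms(1,3)]] by auto
    have "(1 - e) *\<^sub>R x + e *\<^sub>R z - z = (e - 1) *\<^sub>R (z - x)"
      by (simp add: algebra_simps)
    moreover have "v \<bullet> ((1 - e) *\<^sub>R x + e *\<^sub>R z - z) \<le> 0"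
      using assms(2,4) e(2) by (auto simp: normal_cone_def)
    ultimately have "(e - 1) * (v \<bullet> (z - x)) \<le> 0"
      by (metis inner_scaleR_right)
    with e(1) have "v \<bullet> (z - x) \<le> 0"
      by (simp add: mult_le_0_iff)
    moreover have "v \<bullet> (x - z) \<le> 0"
      using assms(2,4) x by (auto simp: normal_cone_def)
    ultimately show ?thesis
      by (simp add: inner_diff_right)
  qed
  have "orthogonal v u"
  proof (rule orthogonal_to_span[OF u])
    fix w assume "w \<in> {x - y |x y. x \<in> f \<and> y \<in> f}"
    then show "orthogonal v w"
      by (auto simp: orthogonal_def inner_diff_right const)
  qed
  then show ?thesis
    by (simp add: orthogonal_def inner_commute)
qed

theorem corollary3p4:
  fixes M :: "'w measure"
    and g :: "'w \<Rightarrow> real ^ 'n"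
    and Q :: "(real ^ 'n) set"
    and p :: "real ^ 'n"
    and \<epsilon> :: real
    and s :: "(real ^ 'n) set \<Rightarrow> real ^ 'n"
  assumes "prob_space M"
    and "distributed M lborel g (\<lambda>x. ennreal (std_gaussian_density x))"
    and "polytope Q" and "Q \<noteq> {}"
    and "\<epsilon> \<ge> 0"
    and "\<And>f. f edge_of Q \<Longrightarrow> norm (s f) = 1 \<and> s f \<in> span {x - y | x y. x \<in> f \<and> y \<in> f}"
  shows "measure M {\<omega> \<in> space M. \<not> exact_regularization Q (\<lambda>x. p \<bullet> x) \<epsilon> (g \<omega>)}
    \<le> \<epsilon> * (exp 1 / sqrt (2 * pi)) *
      (\<Sum>f | f edge_of Q. gamma_rel (face_normal_cone Q f) * \<bar>s f \<bullet> p\<bar>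
        * exp (\<epsilon> * sqrt (real CARD('n) - 1) * norm p))"
proof -
  interpret prob_space M by fact
  have gm: "g \<in> measurable M lborel"
    using assms(2) by (rule distributed_measurable)
  have distr: "distr M lborel g = std_gaussian"
    using assms(2) by (simp add: std_gaussian_def distributed_distr_eq_density)
  interpret G: prob_space "std_gaussian :: (real ^ 'n) measure"
    unfolding distr[symmetric] by (rule prob_space_distr) fact
  let ?X = "exp (\<epsilon> * sqrt (real CARD('n) - 1) * norm p)"
  let ?N = "face_normal_cone Q"
  let ?c = "\<lambda>f. 1 / sqrt (2 * pi) * (\<epsilon> * \<bar>s f \<bullet> p\<bar>) * ?X * gamma_rel (?N f)"
  have "\<exists>B. B \<in> sets borel \<and> (\<forall>t\<in>{0..\<epsilon>}. \<forall>x. x - t *\<^sub>R p \<in> ?N f \<longrightarrow> x \<in> B) \<and> measure std_gaussian B \<le> ?c f"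
    if f: "f edge_of Q" for f
  proof -
    have face: "f face_of Q" "convex f" "f \<subseteq> Q" "f \<noteq> {}"
      using f by (auto simp: edge_of_def face_of_imp_convex face_of_imp_subset)
    then obtain z where z: "z \<in> rel_interior f"
      using rel_interior_eq_empty by blast
    have N: "?N f = normal_cone Q z"
      by (rule face_normal_cone_eq) (use assms(3) face z polytope_imp_convex in auto)
    have sub: "?N f \<subseteq> {v. s f \<bullet> v = 0}"
      unfolding N using normal_cone_orthogonal_face[OF face(2,3) z] assms(6)[OF f] by blast
    have norm: "norm (s f) = 1" and cone: "closed (?N f)" "cone (?N f)"
      using assms(6)[OF f] by (simp_all add: N closed_normal_cone cone_normal_cone)
    obtain B where B: "B \<in> sets borel" "\<And>t x. t \<in> {0..\<epsilon>} \<Longrightarrow> x - t *\<^sub>R p \<in> ?N f \<Longrightarrow> x \<in> B"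
      "emeasure std_gaussian B \<le> ennreal (1 / sqrt (2 * pi) * (\<epsilon> * \<bar>s f \<bullet> p\<bar>) * ?X)
        * emeasure std_gaussian {x. closest_point (span (?N f)) x \<in> ?N f}"
      using std_gaussian_sweep_le[OF norm cone sub assms(5), of p] by blast
    have "ennreal (measure std_gaussian B) \<le> ennreal (?c f)"
      using B(3) assms(5) by (simp add: G.emeasure_eq_measure gamma_rel_def flip: ennreal_mult)
    then have "measure std_gaussian B \<le> ?c f"
      using assms(5) by (subst (asm) ennreal_le_iff) (auto simp: gamma_rel_def)
    with B show ?thesis by blast
  qed
  then obtain B where B: "\<And>f. f edge_of Q \<Longrightarrow> B f \<in> sets borel"
      "\<And>f t x. f edge_of Q \<Longrightarrow> t \<in> {0..\<epsilon>} \<Longrightarrow> x - t *\<^sub>R p \<in> ?N f \<Longrightarrow> x \<in> B f"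
      "\<And>f. f edge_of Q \<Longrightarrow> measure std_gaussian (B f) \<le> ?c f"
    by metis
  let ?S = "{f. f edge_of Q}"
  have fin: "finite ?S"
    by (rule finite_subset[OF _ finite_polytope_faces[OF assms(3)]]) (auto simp: edge_of_def)
  have U: "(\<Union>f\<in>?S. B f) \<in> sets borel"
    using fin B(1) by (intro sets.finite_UN) auto
  have "measure M {\<omega> \<in> space M. \<not> exact_regularization Q (\<lambda>x. p \<bullet> x) \<epsilon> (g \<omega>)}
      \<le> measure M (g -` (\<Union>f\<in>?S. B f) \<inter> space M)"
  \<comment> \<open>Failure puts \<open>g \<omega>\<close> into the cover of some edge; the finite
    union of covers is Borel, so its preimage is measurable.\<close>
  proof (rule finite_measure_mono)
    show "{\<omega> \<in> space M. \<not> exact_regularization Q (\<lambda>x. p \<bullet> x) \<epsilon> (g \<omega>)} \<subseteq> g -` (\<Union>f\<in>?S. B f) \<inter> space M"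
    proof
      fix \<omega> assume \<omega>: "\<omega> \<in> {\<omega> \<in> space M. \<not> exact_regularization Q (\<lambda>x. p \<bullet> x) \<epsilon> (g \<omega>)}"
      then obtain t f where "t \<in> {0..\<epsilon>}" "f edge_of Q" "g \<omega> - t *\<^sub>R p \<in> ?N f"
        using not_exact_regularization_imp[OF assms(3,4,5), of p "g \<omega>"] by blast
      then have "f \<in> ?S" "g \<omega> \<in> B f"
        using B(2) by auto
      then show "\<omega> \<in> g -` (\<Union>f\<in>?S. B f) \<inter> space M"
        using \<omega> by blast
    qed
    show "g -` (\<Union>f\<in>?S. B f) \<inter> space M \<in> sets M"
      using measurable_sets[OF gm] U by simp
  qed
  also have "\<dots> = measure std_gaussian (\<Union>f\<in>?S. B f)"
    using measure_distr[OF gm, of "\<Union>f\<in>?S. B f"] U by (simp add: distr)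
  also have "\<dots> \<le> (\<Sum>f\<in>?S. measure std_gaussian (B f))"
    using fin B(1) by (intro G.finite_measure_subadditive_finite) auto
  also have "\<dots> \<le> (\<Sum>f\<in>?S. ?c f)"
    using B(3) by (intro sum_mono) auto
  also have "\<dots> = \<epsilon> * (1 / sqrt (2 * pi)) * (\<Sum>f\<in>?S. gamma_rel (?N f) * \<bar>s f \<bullet> p\<bar> * ?X)"
    by (simp add: sum_distrib_left mult_ac)
  \<comment> \<open>The argument yields the constant \<open>1 / sqrt (2 * pi)\<close>; it is relaxed
    using \<open>1 \<le> exp 1\<close>.\<close>
  also have "\<dots> \<le> \<epsilon> * (exp 1 / sqrt (2 * pi)) * (\<Sum>f\<in>?S. gamma_rel (?N f) * \<bar>s f \<bullet> p\<bar> * ?X)"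
    using assms(5) by (intro mult_right_mono mult_left_mono divide_right_mono sum_nonneg)
      (auto simp: gamma_rel_def)
  finally show ?thesis .
qed

end
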